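(* Let $G$ be an Abelian group (written multiplicatively), $R$ a commutative ring with unity, $\varphi:\mathbb{Z}^d\to G$ a homomorphism, and $\Delta$ a $d$-dimensional half-open simplex with vertices $v_1,\dots,v_{d+1}\in\mathbb{Z}^d$. Let $w\in R[x_1,\dots,x_d]$ be a polynomial of degree $m$. Then the $(\varphi,w)$-Ehrhart series $$\mathcal E(\Delta,\varphi,w;t)=\sum_{n\ge0}\Big(\sum_{\alpha\in n\Delta\cap\mathbb{Z}^d}w(\alpha)\varphi(\alpha)\Big)t^n\in R[G][[t]]$$ can be written as a rational function with denominator $\prod_{i=1}^{d+1}\big(1-\varphi(v_i)t\big)^{m+1}$, i.e., $\prod_{i=1}^{d+1}(1-\varphi(v_i)t)^{m+1}\cdot\mathcal E(\Delta,\varphi,w;t)$ is a polynomial in $t$ with coefficients in $R[G]$.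
   Context: $R[G]$ is the group ring. A half-open simplex with vertices $v_1,\dots,v_{d+1}$ (affinely independent) is $\Delta=\{\sum_i\lambda_iv_i:\sum_i\lambda_i=1,\ \lambda_i>0\ (i\in S),\ \lambda_i\ge0\ (i\notin S)\}$ for some $S\subseteq\{1,\dots,d+1\}$, and $n\Delta=\{\sum_i\lambda_iv_i:\sum_i\lambda_i=n,\ \text{same strict/weak conditions}\}$ for $n\ge0$. *)

theory Defs
  imports "HOL-Analysis.Analysis" "HOL-Library.Poly_Mapping"
    "HOL-Computational_Algebra.Polynomial_FPS"
begin

text \<open>
  The group ring \<open>R[G]\<close> is the type \<open>'g \<Rightarrow>\<^sub>0 'r\<close> of finitely supported functions with the
  convolution product of \<^theory>\<open>HOL-Library.Poly_Mapping\<close>. That product is taken with respect to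
  the addition of \<open>'g\<close>, so the Abelian group \<open>G\<close> is an additive type of class \<open>ab_group_add\<close>;
  the element \<open>r g\<close> of \<open>R[G]\<close> is \<open>Poly_Mapping.single g r\<close>.

  Likewise \<open>R[x\<^sub>1, \<dots>, x\<^sub>d]\<close> is the monoid ring \<open>('d \<Rightarrow>\<^sub>0 nat) \<Rightarrow>\<^sub>0 'r\<close>: exponent vectors are mapped
  to coefficients.
\<close>

definition mpoly_total_degree :: "(('d::finite \<Rightarrow>\<^sub>0 nat) \<Rightarrow>\<^sub>0 'r::zero) \<Rightarrow> nat" where
  "mpoly_total_degree w =
     Max (insert 0 ((\<lambda>e. \<Sum>i\<in>UNIV. Poly_Mapping.lookup e i) ` Poly_Mapping.keys w))"

definition mpoly_eval_int :: "(('d::finite \<Rightarrow>\<^sub>0 nat) \<Rightarrow>\<^sub>0 'r::comm_ring_1) \<Rightarrow> int ^ 'd \<Rightarrow> 'r" where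
  "mpoly_eval_int w \<alpha> =
     (\<Sum>e\<in>Poly_Mapping.keys w.
        Poly_Mapping.lookup w e * (\<Prod>i\<in>UNIV. of_int (\<alpha> $ i) ^ Poly_Mapping.lookup e i))"

definition real_of_int_vec :: "int ^ 'd \<Rightarrow> real ^ 'd" where
  "real_of_int_vec \<alpha> = (\<chi> i. real_of_int (\<alpha> $ i))"

text \<open>
  Since \<open>affine_dependent\<close> is a predicate on sets, affine independence of a family of points also
  requires the points to be distinct.
\<close>

definition affinely_independent_vertices :: "(nat \<Rightarrow> int ^ 'd::finite) \<Rightarrow> bool" where
  "affinely_independent_vertices v \<longleftrightarrow>
     inj_on v {1..CARD('d) + 1} \<and>
     \<not> affine_dependent ((\<lambda>i. real_of_int_vec (v i)) ` {1..CARD('d) + 1})"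

text \<open>
  \<open>n\<Delta>\<close> for the half-open simplex \<open>\<Delta>\<close> with vertices \<open>v\<^sub>1, \<dots>, v\<^bsub>d+1\<^esub>\<close> and strict inequalities
  at the indices in \<open>S\<close>; \<open>\<Delta>\<close> itself is the case \<open>n = 1\<close>. For \<open>n = 0\<close> this is \<open>{0}\<close> if \<open>S\<close> is
  empty, and empty otherwise.
\<close>

definition half_open_simplex_dilate ::
    "(nat \<Rightarrow> int ^ 'd::finite) \<Rightarrow> nat set \<Rightarrow> nat \<Rightarrow> (real ^ 'd) set" where
  "half_open_simplex_dilate v S n =
     {\<Sum>i = 1..CARD('d) + 1. l i *\<^sub>R real_of_int_vec (v i) | l :: nat \<Rightarrow> real.
        (\<Sum>i = 1..CARD('d) + 1. l i) = real n \<and>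
        (\<forall>i\<in>{1..CARD('d) + 1}. if i \<in> S then l i > 0 else l i \<ge> 0)}"

definition lattice_points :: "(real ^ 'd) set \<Rightarrow> (int ^ 'd) set" where
  "lattice_points P = {\<alpha>. real_of_int_vec \<alpha> \<in> P}"

text \<open>The inner sums of the Ehrhart series below are over finite sets.\<close>

lemma finite_lattice_points_half_open_simplex_dilate:
  fixes v :: "nat \<Rightarrow> int ^ 'd::finite"
  shows "finite (lattice_points (half_open_simplex_dilate v S n))"
proof -
  define B where "B = (\<Sum>i = 1..CARD('d) + 1. real n * norm (real_of_int_vec (v i)))"
  have bound: "norm x \<le> B" if "x \<in> half_open_simplex_dilate v S n" for x
  proof -
    from that obtain l :: "nat \<Rightarrow> real" where
      x: "x = (\<Sum>i = 1..CARD('d) + 1. l i *\<^sub>R real_of_int_vec (v i))" and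
      s: "(\<Sum>i = 1..CARD('d) + 1. l i) = real n" and
      p: "\<forall>i\<in>{1..CARD('d) + 1}. if i \<in> S then l i > 0 else l i \<ge> 0"
      unfolding half_open_simplex_dilate_def by blast
    have nn: "l i \<ge> 0" if "i \<in> {1..CARD('d) + 1}" for i
      using bspec[OF p that] by (simp split: if_splits)
    have le: "l i \<le> real n" if "i \<in> {1..CARD('d) + 1}" for i
      using member_le_sum[of i "{1..CARD('d) + 1}" l] that nn s by auto
    show ?thesis unfolding x B_def
      by (rule sum_norm_le) (auto intro!: mult_right_mono le simp: nn)
  qed
  let ?F = "PiE (UNIV :: 'd set) (\<lambda>_. {- \<lceil>B\<rceil>..\<lceil>B\<rceil>})"
  have "lattice_points (half_open_simplex_dilate v S n) \<subseteq> vec_lambda ` ?F"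
  proof
    fix \<alpha> assume "\<alpha> \<in> lattice_points (half_open_simplex_dilate v S n)"
    then have b: "norm (real_of_int_vec \<alpha>) \<le> B"
      by (simp add: lattice_points_def bound)
    have "\<bar>\<alpha> $ i\<bar> \<le> \<lceil>B\<rceil>" for i
    proof -
      have "\<bar>real_of_int (\<alpha> $ i)\<bar> \<le> B"
        using component_le_norm_cart[of "real_of_int_vec \<alpha>" i] b
        by (simp add: real_of_int_vec_def)
      then show ?thesis by linarith
    qed
    then have "vec_nth \<alpha> \<in> ?F" by (auto simp: abs_le_iff minus_le_iff)
    then show "\<alpha> \<in> vec_lambda ` ?F" by (metis image_eqI vec_nth_inverse)
  qed
  moreover have "finite ?F" by (rule finite_PiE) auto
  ultimately show ?thesis by (meson finite_imageI finite_subset)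
qed

definition ehrhart_series ::
    "(nat \<Rightarrow> int ^ 'd::finite) \<Rightarrow> nat set \<Rightarrow> (int ^ 'd \<Rightarrow> 'g::ab_group_add) \<Rightarrow>
      (('d \<Rightarrow>\<^sub>0 nat) \<Rightarrow>\<^sub>0 'r::comm_ring_1) \<Rightarrow> ('g \<Rightarrow>\<^sub>0 'r) fps" where
  "ehrhart_series v S \<phi> w =
     Abs_fps (\<lambda>n. \<Sum>\<alpha>\<in>lattice_points (half_open_simplex_dilate v S n).
        Poly_Mapping.single (\<phi> \<alpha>) (mpoly_eval_int w \<alpha>))"

end

theory Submission
  imports Defs
begin

text \<open>
  Let \<open>F(n, \<alpha>) = w(\<alpha>)\<close> if \<open>\<alpha> \<in> n\<Delta>\<close> and \<open>0\<close> otherwise. Multiplying the series by \<open>1 - \<phi>(v\<^sub>i) t\<close>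
  replaces \<open>F\<close> by \<open>D\<^sub>i F(n, \<alpha>) = F(n, \<alpha>) - F(n - 1, \<alpha> - v\<^sub>i)\<close>. Let \<open>l\<^sub>1, \<dots>, l\<^bsub>d+1\<^esub>\<close> be the
  coordinates of \<open>(n, \<alpha>)\<close> with respect to the vectors \<open>(1, v\<^sub>i)\<close>. Where \<open>l\<^sub>j > m + 1\<close>, moving by at
  most \<open>m + 1\<close> steps \<open>(1, v\<^sub>j)\<close> does not affect membership in the cone over \<open>\<Delta>\<close>, so there
  \<open>D\<^sub>j\<^bsup>m+1\<^esup> F\<close> is an \<open>(m + 1)\<close>-st finite difference of \<open>w\<close> and vanishes; the other \<open>D\<^sub>i\<close> do not
  change \<open>l\<^sub>j\<close> and hence preserve this vanishing. If \<open>n > (d + 1)(m + 1)\<close>, then some \<open>l\<^sub>j\<close> exceeds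
  \<open>m + 1\<close>.
\<close>

section \<open>Iterated differences of polynomial functions\<close>

definition backward_diff :: "'a::ab_group_add \<Rightarrow> ('a \<Rightarrow> 'b::ab_group_add) \<Rightarrow> 'a \<Rightarrow> 'b" where
  "backward_diff u f = (\<lambda>x. f x - f (x - u))"

lemma backward_diff_funpow_zero: "(backward_diff u ^^ k) (\<lambda>x. 0) = (\<lambda>x. 0)"
  by (induction k) (auto simp: backward_diff_def)

lemma backward_diff_funpow_add:
  "(backward_diff u ^^ k) (\<lambda>x. f x + g x) =
     (\<lambda>x. (backward_diff u ^^ k) f x + (backward_diff u ^^ k) g x)"
  by (induction k) (auto simp: backward_diff_def)

lemma backward_diff_funpow_shift:
  "(backward_diff u ^^ k) (\<lambda>x. f (x - u)) = (\<lambda>x. (backward_diff u ^^ k) f (x - u))"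
  by (induction k) (auto simp: backward_diff_def)

lemma backward_diff_funpow_eq_0_mono:
  assumes "(backward_diff u ^^ k) f = (\<lambda>x. 0)" "k \<le> n"
  shows "(backward_diff u ^^ n) f = (\<lambda>x. 0)"
proof -
  obtain r where "n = r + k" using assms(2) by (metis add.commute le_Suc_ex)
  then show ?thesis using assms(1) by (simp add: funpow_add backward_diff_funpow_zero)
qed

lemma backward_diff_funpow_sum:
  assumes "\<And>i. i \<in> A \<Longrightarrow> (backward_diff u ^^ k) (f i) = (\<lambda>x. 0)"
  shows "(backward_diff u ^^ k) (\<lambda>x. \<Sum>i\<in>A. f i x) = (\<lambda>x. 0)"
  using assms
  by (induction A rule: infinite_finite_induct)
    (auto simp: backward_diff_funpow_zero backward_diff_funpow_add)

text \<open>Being annihilated by \<open>backward_diff u ^^ Suc a\<close> stands in for having degree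
  at most \<open>a\<close> along \<open>u\<close>, so the degree bounds add. The discrete Leibniz
  rule splits the difference of a product into two products, in each of which one of the two bounds
  has dropped by one.\<close>

lemma backward_diff_funpow_mult:
  fixes f g :: "'a::ab_group_add \<Rightarrow> 'r::comm_ring_1"
  assumes "(backward_diff u ^^ Suc a) f = (\<lambda>x. 0)" "(backward_diff u ^^ Suc b) g = (\<lambda>x. 0)"
  shows "(backward_diff u ^^ Suc (a + b)) (\<lambda>x. f x * g x) = (\<lambda>x. 0)"
  using assms
proof (induction "a + b" arbitrary: a b f g rule: less_induct)
  case less
  let ?D = "backward_diff u"
  have product_rule: "?D (\<lambda>x. f x * g x) = (\<lambda>x. ?D f x * g x + f (x - u) * ?D g x)"
    by (auto simp: backward_diff_def algebra_simps)
  have left: "(?D ^^ (a + b)) (\<lambda>x. ?D f x * g x) = (\<lambda>x. 0)"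
  proof (cases a)
    \<comment> \<open>The bound cannot drop below 0, but here the factor \<open>?D f\<close> is
      already zero.\<close>
    case 0
    then have "?D f = (\<lambda>x. 0)" using less.prems by simp
    then show ?thesis by (simp add: backward_diff_funpow_zero)
  next
    case (Suc a')
    have "(?D ^^ Suc a') (?D f) = (\<lambda>x. 0)"
      using less.prems(1) Suc by (simp add: funpow_swap1)
    from less.hyps[OF _ this less.prems(2)] Suc show ?thesis by simp
  qed
  have right: "(?D ^^ (a + b)) (\<lambda>x. f (x - u) * ?D g x) = (\<lambda>x. 0)"
  proof (cases b)
    case 0
    then have "?D g = (\<lambda>x. 0)" using less.prems by simp
    then show ?thesis by (simp add: backward_diff_funpow_zero)
  next
    case (Suc b')
    have 1: "(?D ^^ Suc b') (?D g) = (\<lambda>x. 0)"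
      using less.prems(2) Suc by (simp add: funpow_swap1)
    \<comment> \<open>The Leibniz rule evaluates one factor at \<open>x - u\<close>; translation
      commutes with differences, so the bound for \<open>f\<close> carries over.\<close>
    have 2: "(?D ^^ Suc a) (\<lambda>x. f (x - u)) = (\<lambda>x. 0)"
      unfolding backward_diff_funpow_shift less.prems(1) ..
    from less.hyps[OF _ 2 1] Suc show ?thesis by simp
  qed
  have "(?D ^^ Suc (a + b)) (\<lambda>x. f x * g x) = (?D ^^ (a + b)) (?D (\<lambda>x. f x * g x))"
    by (simp add: funpow_swap1)
  then show ?case
    unfolding product_rule backward_diff_funpow_add left right by simp
qed

lemma backward_diff_funpow_power:
  fixes f :: "'a::ab_group_add \<Rightarrow> 'r::comm_ring_1"
  assumes "(backward_diff u ^^ Suc a) f = (\<lambda>x. 0)"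
  shows "(backward_diff u ^^ Suc (k * a)) (\<lambda>x. f x ^ k) = (\<lambda>x. 0)"
proof (induction k)
  case 0
  show ?case by (auto simp: backward_diff_def)
next
  case (Suc k)
  from backward_diff_funpow_mult[OF assms Suc] show ?case by simp
qed

lemma backward_diff_funpow_prod:
  fixes f :: "'i \<Rightarrow> 'a::ab_group_add \<Rightarrow> 'r::comm_ring_1"
  assumes "finite A" "\<And>i. i \<in> A \<Longrightarrow> (backward_diff u ^^ Suc (a i)) (f i) = (\<lambda>x. 0)"
  shows "(backward_diff u ^^ Suc (\<Sum>i\<in>A. a i)) (\<lambda>x. \<Prod>i\<in>A. f i x) = (\<lambda>x. 0)"
  using assms
proof (induction A)
  case empty
  show ?case by (auto simp: backward_diff_def)
next
  case (insert i A)
  have "(backward_diff u ^^ Suc (a i + (\<Sum>i\<in>A. a i))) (\<lambda>x. f i x * (\<Prod>i\<in>A. f i x)) = (\<lambda>x. 0)"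
    using insert.prems insert.IH by (intro backward_diff_funpow_mult) auto
  with insert.hyps show ?case by simp
qed

text \<open>The difference of a coordinate function is constant, so coordinates have degree at most
  1; powers, products and constants then give each monomial its own degree as bound. Monomials below
  the total degree vanish at the larger order too.\<close>

lemma backward_diff_funpow_mpoly_eval_int:
  fixes w :: "('d::finite \<Rightarrow>\<^sub>0 nat) \<Rightarrow>\<^sub>0 'r::comm_ring_1"
  shows "(backward_diff u ^^ Suc (mpoly_total_degree w)) (mpoly_eval_int w) = (\<lambda>x. 0)"
proof -
  have monomial: "(backward_diff u ^^ Suc (mpoly_total_degree w))
      (\<lambda>\<alpha>. Poly_Mapping.lookup w e * (\<Prod>i\<in>UNIV. of_int (\<alpha> $ i) ^ Poly_Mapping.lookup e i)) =
      (\<lambda>x. 0)" if e: "e \<in> Poly_Mapping.keys w" for e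
  proof -
    let ?s = "\<Sum>i\<in>UNIV. Poly_Mapping.lookup e i"
    have coord: "(backward_diff u ^^ Suc 1) (\<lambda>\<alpha>. of_int (\<alpha> $ i) :: 'r) = (\<lambda>x. 0)" for i
      by (auto simp: backward_diff_def)
    have "(backward_diff u ^^ Suc (Poly_Mapping.lookup e i))
        (\<lambda>\<alpha>. of_int (\<alpha> $ i) ^ Poly_Mapping.lookup e i :: 'r) = (\<lambda>x. 0)" for i
      using backward_diff_funpow_power[OF coord] by simp
    then have "(backward_diff u ^^ Suc ?s)
        (\<lambda>\<alpha>. \<Prod>i\<in>UNIV. of_int (\<alpha> $ i) ^ Poly_Mapping.lookup e i :: 'r) = (\<lambda>x. 0)"
      by (intro backward_diff_funpow_prod) auto
    moreover have "(backward_diff u ^^ Suc 0) (\<lambda>\<alpha>. Poly_Mapping.lookup w e) = (\<lambda>x. 0)"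
      by (auto simp: backward_diff_def)
    ultimately have "(backward_diff u ^^ Suc (0 + ?s))
        (\<lambda>\<alpha>. Poly_Mapping.lookup w e *
           (\<Prod>i\<in>UNIV. of_int (\<alpha> $ i) ^ Poly_Mapping.lookup e i)) = (\<lambda>x. 0)"
      by (intro backward_diff_funpow_mult)
    moreover have "?s \<le> mpoly_total_degree w"
      unfolding mpoly_total_degree_def using e by (intro Max_ge) auto
    then have "Suc (0 + ?s) \<le> Suc (mpoly_total_degree w)" by simp
    ultimately show ?thesis by (rule backward_diff_funpow_eq_0_mono)
  qed
  have "(backward_diff u ^^ Suc (mpoly_total_degree w))
      (\<lambda>\<alpha>. \<Sum>e\<in>Poly_Mapping.keys w. Poly_Mapping.lookup w e *
         (\<Prod>i\<in>UNIV. of_int (\<alpha> $ i) ^ Poly_Mapping.lookup e i)) = (\<lambda>x. 0)"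
    by (intro backward_diff_funpow_sum monomial)
  then show ?thesis by (simp add: mpoly_eval_int_def[abs_def])
qed

section \<open>Differences graded by the dilation factor, and their generating series\<close>

text \<open>The value 0 in the first case amounts to extending \<open>F\<close> by zero to negative
  \<open>n\<close>, matching the absence of negative powers in a power series.\<close>

definition graded_diff ::
    "'a::ab_group_add \<Rightarrow> (nat \<Rightarrow> 'a \<Rightarrow> 'b::ab_group_add) \<Rightarrow> nat \<Rightarrow> 'a \<Rightarrow> 'b" where
  "graded_diff u F n x = F n x - (case n of 0 \<Rightarrow> 0 | Suc k \<Rightarrow> F k (x - u))"

lemma graded_diff_simps [simp]:
  "graded_diff u F 0 x = F 0 x"
  "graded_diff u F (Suc k) x = F (Suc k) x - F k (x - u)"
  by (simp_all add: graded_diff_def)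

lemma graded_diff_commute:
  "graded_diff u (graded_diff u' F) = graded_diff u' (graded_diff u F)"
proof (intro ext)
  fix n x
  show "graded_diff u (graded_diff u' F) n x = graded_diff u' (graded_diff u F) n x"
  proof (cases n)
    case (Suc k)
    then show ?thesis by (cases k) (simp_all add: algebra_simps)
  qed simp
qed

lemma graded_diff_funpow_commute:
  "(graded_diff u ^^ k) ((graded_diff u' ^^ k') F) = (graded_diff u' ^^ k') ((graded_diff u ^^ k) F)"
proof -
  have 1: "graded_diff u ((graded_diff u' ^^ k') H) = (graded_diff u' ^^ k') (graded_diff u H)" for H
    by (induction k') (simp_all add: graded_diff_commute[of u u'])
  show ?thesis by (induction k) (simp_all add: 1)
qed

text \<open>The region \<open>P\<close> is closed under the step from \<open>(n, x)\<close> to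
  \<open>(n - 1, x - u)\<close>, so differences taken inside it read only values of \<open>F\<close>
  from inside it.\<close>

lemma graded_diff_funpow_eq_0:
  assumes "\<And>n x. P n x \<Longrightarrow> F n x = 0"
    and "\<And>n x. P (Suc n) x \<Longrightarrow> P n (x - u)"
    and "P n x"
  shows "(graded_diff u ^^ k) F n x = 0"
  using assms(3)
proof (induction k arbitrary: n x)
  case 0
  then show ?case using assms(1) by simp
next
  case (Suc k)
  then show ?case using assms(2) by (cases n) auto
qed

lemma finite_support_graded_diff:
  assumes "\<And>n. finite {x. F n x \<noteq> 0}"
  shows "finite {x. graded_diff u F n x \<noteq> 0}"
proof (cases n)
  case (Suc k)
  have "{x. graded_diff u F n x \<noteq> 0} \<subseteq> {x. F n x \<noteq> 0} \<union> (\<lambda>x. x + u) ` {x. F k x \<noteq> 0}"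
  proof
    fix x assume "x \<in> {x. graded_diff u F n x \<noteq> 0}"
    then have "F n x \<noteq> 0 \<or> F k (x - u) \<noteq> 0" by (auto simp: Suc)
    then show "x \<in> {x. F n x \<noteq> 0} \<union> (\<lambda>x. x + u) ` {x. F k x \<noteq> 0}"
      by (auto intro!: image_eqI[where x = "x - u"])
  qed
  then show ?thesis using assms by (meson finite_UnI finite_imageI finite_subset)
qed (simp add: assms)

text \<open>Summing over the support makes sense for every \<open>F\<close>, but an infinite support
  would yield the default value 0; hence finiteness is carried along below.\<close>

definition graded_series ::
    "('a \<Rightarrow> 'g) \<Rightarrow> (nat \<Rightarrow> 'a \<Rightarrow> 'r) \<Rightarrow> ('g::ab_group_add \<Rightarrow>\<^sub>0 'r::comm_ring_1) fps" where
  "graded_series \<phi> F = Abs_fps (\<lambda>n. \<Sum>x | F n x \<noteq> 0. Poly_Mapping.single (\<phi> x) (F n x))"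

lemma graded_series_nth:
  assumes "finite A" "{x. F n x \<noteq> 0} \<subseteq> A"
  shows "fps_nth (graded_series \<phi> F) n = (\<Sum>x\<in>A. Poly_Mapping.single (\<phi> x) (F n x))"
  unfolding graded_series_def fps_nth_Abs_fps
  using assms by (intro sum.mono_neutral_left) auto

text \<open>Since \<phi> is additive, multiplying by \<open>Poly_Mapping.single (\<phi> u) 1\<close>
  is the reindexing \<open>x\<close> to \<open>x + u\<close> of the inner sum.\<close>

lemma graded_series_graded_diff:
  fixes \<phi> :: "'a::ab_group_add \<Rightarrow> 'g::ab_group_add" and F :: "nat \<Rightarrow> 'a \<Rightarrow> 'r::comm_ring_1"
  assumes "Modules.additive \<phi>" and fin: "\<And>n. finite {x. F n x \<noteq> 0}"
  shows "graded_series \<phi> (graded_diff u F) =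
    (1 - fps_const (Poly_Mapping.single (\<phi> u) 1) * fps_X) * graded_series \<phi> F"
proof (rule fps_ext)
  fix n
  let ?c = "Poly_Mapping.single (\<phi> u) (1::'r)"
  have rhs: "fps_nth ((1 - fps_const ?c * fps_X) * graded_series \<phi> F) n =
      fps_nth (graded_series \<phi> F) n - (case n of 0 \<Rightarrow> 0 | Suc k \<Rightarrow> ?c * fps_nth (graded_series \<phi> F) k)"
    by (cases n) (simp_all add: left_diff_distrib mult.assoc)
  show "fps_nth (graded_series \<phi> (graded_diff u F)) n =
      fps_nth ((1 - fps_const ?c * fps_X) * graded_series \<phi> F) n"
  proof (cases n)
    case 0
    then show ?thesis unfolding rhs by (simp add: graded_series_def)
  next
    case (Suc k)
    \<comment> \<open>A common finite index set for all three sums, so that they can be compared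
      term by term.\<close>
    define A where "A = {x. F n x \<noteq> 0} \<union> {x. graded_diff u F n x \<noteq> 0} \<union> (\<lambda>x. x + u) ` {x. F k x \<noteq> 0}"
    have A: "finite A"
      unfolding A_def using fin finite_support_graded_diff[OF fin] by simp
    have "?c * fps_nth (graded_series \<phi> F) k =
        (\<Sum>x | F k x \<noteq> 0. Poly_Mapping.single (\<phi> (x + u)) (F k x))"
      unfolding graded_series_def
      by (simp add: sum_distrib_left mult_single additive.add[OF assms(1)] add.commute)
    also have "\<dots> = (\<Sum>x\<in>(\<lambda>x. x + u) ` {x. F k x \<noteq> 0}. Poly_Mapping.single (\<phi> x) (F k (x - u)))"
      by (subst sum.reindex) (auto simp: inj_on_def)
    also have "\<dots> = (\<Sum>x\<in>A. Poly_Mapping.single (\<phi> x) (F k (x - u)))"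
    proof (rule sum.mono_neutral_left[OF A])
      show "\<forall>x\<in>A - (\<lambda>x. x + u) ` {x. F k x \<noteq> 0}. Poly_Mapping.single (\<phi> x) (F k (x - u)) = 0"
      proof
        fix x assume "x \<in> A - (\<lambda>x. x + u) ` {x. F k x \<noteq> 0}"
        then have "F k (x - u) = 0" by (metis (mono_tags) DiffD2 diff_add_cancel image_eqI mem_Collect_eq)
        then show "Poly_Mapping.single (\<phi> x) (F k (x - u)) = 0" by simp
      qed
    qed (auto simp: A_def)
    finally have *: "?c * fps_nth (graded_series \<phi> F) k = \<dots>" .
    have F: "fps_nth (graded_series \<phi> F) n = (\<Sum>x\<in>A. Poly_Mapping.single (\<phi> x) (F n x))"
      by (rule graded_series_nth[OF A]) (auto simp: A_def)
    have "fps_nth (graded_series \<phi> (graded_diff u F)) n =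
        (\<Sum>x\<in>A. Poly_Mapping.single (\<phi> x) (graded_diff u F n x))"
      by (rule graded_series_nth[OF A]) (auto simp: A_def)
    also have "\<dots> = fps_nth (graded_series \<phi> F) n - ?c * fps_nth (graded_series \<phi> F) k"
      unfolding * F by (simp add: Suc single_diff sum_subtractf)
    finally show ?thesis unfolding rhs by (simp add: Suc)
  qed
qed

lemma graded_series_graded_diff_funpow:
  fixes \<phi> :: "'a::ab_group_add \<Rightarrow> 'g::ab_group_add" and F :: "nat \<Rightarrow> 'a \<Rightarrow> 'r::comm_ring_1"
  assumes "Modules.additive \<phi>" and fin: "\<And>n. finite {x. F n x \<noteq> 0}"
  shows "(\<forall>n. finite {x. (graded_diff u ^^ k) F n x \<noteq> 0}) \<and>
    graded_series \<phi> ((graded_diff u ^^ k) F) =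
    (1 - fps_const (Poly_Mapping.single (\<phi> u) 1) * fps_X) ^ k * graded_series \<phi> F"
proof (induction k)
  case 0
  show ?case using fin by simp
next
  case (Suc k)
  then show ?case
    by (simp add: finite_support_graded_diff graded_series_graded_diff[OF assms(1)] mult.assoc)
qed

section \<open>Coordinates with respect to the lifted vertices\<close>

text \<open>Signs are left free, so that a point keeps its coordinates when a step
  \<open>(1, v i)\<close> leaves the cone over the simplex.\<close>

definition cone_coords ::
    "(nat \<Rightarrow> int ^ 'd::finite) \<Rightarrow> nat set \<Rightarrow> (nat \<Rightarrow> real) \<Rightarrow> nat \<Rightarrow> int ^ 'd \<Rightarrow> bool" where
  "cone_coords v I l n \<alpha> \<longleftrightarrow>
     (\<Sum>i\<in>I. l i) = real n \<and> (\<Sum>i\<in>I. l i *\<^sub>R real_of_int_vec (v i)) = real_of_int_vec \<alpha>"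

lemma real_of_int_vec_diff: "real_of_int_vec (\<alpha> - \<beta>) = real_of_int_vec \<alpha> - real_of_int_vec \<beta>"
  by (simp add: real_of_int_vec_def vec_eq_iff)

lemma cone_coords_step:
  assumes "finite I" "i \<in> I"
  shows "cone_coords v I (l(i := l i + 1)) (Suc n) \<alpha> \<longleftrightarrow> cone_coords v I l n (\<alpha> - v i)"
proof -
  have 1: "(\<Sum>k\<in>I. (l(i := l i + 1)) k) = (\<Sum>k\<in>I. l k) + 1"
    using assms by (simp add: sum.remove[of I i])
  have 2: "(\<Sum>k\<in>I. (l(i := l i + 1)) k *\<^sub>R real_of_int_vec (v k)) =
      (\<Sum>k\<in>I. l k *\<^sub>R real_of_int_vec (v k)) + real_of_int_vec (v i)"
    using assms by (simp add: sum.remove[of I i] scaleR_left_distrib)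
  show ?thesis
    unfolding cone_coords_def 1 2 real_of_int_vec_diff by (auto simp: algebra_simps)
qed

text \<open>The difference of two coordinate families has coefficient sum zero and represents the
  zero vector, so a nonzero difference is an affine dependence.\<close>

lemma affinely_independent_vertices_coords_unique:
  fixes v :: "nat \<Rightarrow> int ^ 'd::finite"
  assumes "affinely_independent_vertices v"
    and "cone_coords v {1..CARD('d) + 1} l n \<alpha>" "cone_coords v {1..CARD('d) + 1} l' n \<alpha>"
    and "i \<in> {1..CARD('d) + 1}"
  shows "l i = l' i"
proof (rule ccontr)
  assume ne: "l i \<noteq> l' i"
  let ?I = "{1..CARD('d) + 1}"
  define r where "r = (\<lambda>i. real_of_int_vec (v i))"
  have inj: "inj_on r ?I"
    using assms(1)
    by (auto simp: affinely_independent_vertices_def r_def inj_on_def real_of_int_vec_def vec_eq_iff)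
  \<comment> \<open>\<open>affine_dependent\<close> speaks of sets, so the coefficients must be
    indexed by points; distinctness of the vertices makes this possible.\<close>
  define U where "U = (\<lambda>x. l (the_inv_into ?I r x) - l' (the_inv_into ?I r x))"
  have U: "U (r k) = l k - l' k" if "k \<in> ?I" for k
    unfolding U_def the_inv_into_f_f[OF inj that] ..
  have "sum U (r ` ?I) = (\<Sum>k\<in>?I. l k - l' k)"
    by (subst sum.reindex[OF inj]) (auto intro!: sum.cong simp: U)
  also have "\<dots> = 0"
    using assms(2,3) unfolding cone_coords_def sum_subtractf by simp
  finally have 1: "sum U (r ` ?I) = 0" .
  have "(\<Sum>x\<in>r ` ?I. U x *\<^sub>R x) = (\<Sum>k\<in>?I. (l k - l' k) *\<^sub>R r k)"
    by (subst sum.reindex[OF inj]) (auto intro!: sum.cong simp: U)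
  also have "\<dots> = 0"
    using assms(2,3) unfolding cone_coords_def scaleR_left_diff_distrib sum_subtractf r_def by simp
  finally have 2: "(\<Sum>x\<in>r ` ?I. U x *\<^sub>R x) = 0" .
  have "U (r i) \<noteq> 0" using ne U[OF assms(4)] by simp
  then have "\<exists>x\<in>r ` ?I. U x \<noteq> 0" using assms(4) by blast
  with 1 2 have "affine_dependent (r ` ?I)"
    by (subst affine_dependent_explicit_finite) blast+
  with assms(1) show False by (simp add: affinely_independent_vertices_def r_def)
qed

text \<open>Uniqueness of coordinates turns the existential in the definition of the dilate into a
  sign test on any given family.\<close>

lemma lattice_points_dilate_iff:
  fixes v :: "nat \<Rightarrow> int ^ 'd::finite"
  assumes "affinely_independent_vertices v" "cone_coords v {1..CARD('d) + 1} l n \<alpha>"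
  shows "\<alpha> \<in> lattice_points (half_open_simplex_dilate v S n) \<longleftrightarrow>
    (\<forall>i\<in>{1..CARD('d) + 1}. if i \<in> S then l i > 0 else l i \<ge> 0)"
proof -
  have "\<alpha> \<in> lattice_points (half_open_simplex_dilate v S n) \<longleftrightarrow>
      (\<exists>l. cone_coords v {1..CARD('d) + 1} l n \<alpha> \<and>
        (\<forall>i\<in>{1..CARD('d) + 1}. if i \<in> S then l i > 0 else l i \<ge> 0))"
    unfolding lattice_points_def half_open_simplex_dilate_def cone_coords_def
    by (simp only: mem_Collect_eq eq_commute[of "real_of_int_vec \<alpha>"] conj_ac)
  also have "\<dots> \<longleftrightarrow> (\<forall>i\<in>{1..CARD('d) + 1}. if i \<in> S then l i > 0 else l i \<ge> 0)"
    (is "(\<exists>l. ?coords l \<and> ?pos l) \<longleftrightarrow> ?pos l")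
  proof
    assume "\<exists>l. ?coords l \<and> ?pos l"
    then obtain l' where l': "?coords l'" "?pos l'" by blast
    have "l i = l' i" if "i \<in> {1..CARD('d) + 1}" for i
      by (rule affinely_independent_vertices_coords_unique[OF assms(1,2) l'(1) that])
    with l'(2) show "?pos l" by simp
  next
    assume "?pos l"
    with assms(2) show "\<exists>l. ?coords l \<and> ?pos l" by blast
  qed
  finally show ?thesis .
qed

lemma lattice_points_dilate_coords:
  fixes v :: "nat \<Rightarrow> int ^ 'd::finite"
  assumes "\<alpha> \<in> lattice_points (half_open_simplex_dilate v S n)"
  obtains l where "cone_coords v {1..CARD('d) + 1} l n \<alpha>"
  using assms unfolding lattice_points_def half_open_simplex_dilate_def cone_coords_def
  by fastforce

section \<open>Vanishing of differences far from a facet\<close>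

definition weight_on_dilates ::
    "(nat \<Rightarrow> int ^ 'd::finite) \<Rightarrow> nat set \<Rightarrow> (int ^ 'd \<Rightarrow> 'r::zero) \<Rightarrow> nat \<Rightarrow> int ^ 'd \<Rightarrow> 'r" where
  "weight_on_dilates v S f n \<alpha> =
     (if \<alpha> \<in> lattice_points (half_open_simplex_dilate v S n) then f \<alpha> else 0)"

lemma finite_support_weight_on_dilates: "finite {\<alpha>. weight_on_dilates v S f n \<alpha> \<noteq> 0}"
  by (rule finite_subset[OF _ finite_lattice_points_half_open_simplex_dilate[of v S n]])
    (auto simp: weight_on_dilates_def)

lemma ehrhart_series_eq_graded_series:
  "ehrhart_series v S \<phi> w = graded_series \<phi> (weight_on_dilates v S (mpoly_eval_int w))"
proof (rule fps_ext)
  fix n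
  show "fps_nth (ehrhart_series v S \<phi> w) n =
      fps_nth (graded_series \<phi> (weight_on_dilates v S (mpoly_eval_int w))) n"
    by (subst graded_series_nth[OF finite_lattice_points_half_open_simplex_dilate[of v S n]])
      (auto simp: ehrhart_series_def weight_on_dilates_def)
qed

text \<open>Each step lowers only the \<open>j\<close>-th coordinate, by one. Since it starts above
  \<open>k\<close>, it stays positive for \<open>k\<close> steps, so membership in the dilates does
  not change and the cutoff commutes with the differences.\<close>

lemma graded_diff_funpow_weight_on_dilates:
  fixes v :: "nat \<Rightarrow> int ^ 'd::finite" and f :: "int ^ 'd \<Rightarrow> 'r::ab_group_add"
  assumes "affinely_independent_vertices v" "j \<in> {1..CARD('d) + 1}"
    and "cone_coords v {1..CARD('d) + 1} l n \<alpha>" "l j > real k"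
  shows "(graded_diff (v j) ^^ k) (weight_on_dilates v S f) n \<alpha> =
    weight_on_dilates v S ((backward_diff (v j) ^^ k) f) n \<alpha>"
  using assms(3,4)
proof (induction k arbitrary: n \<alpha> l)
  case 0
  show ?case by simp
next
  case (Suc k)
  let ?I = "{1..CARD('d) + 1}"
  let ?pos = "\<lambda>l. \<forall>i\<in>?I. if i \<in> S then l i > 0 else l i \<ge> (0::real)"
  have mem: "\<alpha> \<in> lattice_points (half_open_simplex_dilate v S n) \<longleftrightarrow> ?pos l"
    by (rule lattice_points_dilate_iff[OF assms(1) Suc.prems(1)])
  have IH: "(graded_diff (v j) ^^ k) (weight_on_dilates v S f) n \<alpha> =
      weight_on_dilates v S ((backward_diff (v j) ^^ k) f) n \<alpha>"
    using Suc.IH[OF Suc.prems(1)] Suc.prems(2) by simp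
  show ?case
  proof (cases n)
    case 0
    \<comment> \<open>In degree 0 the coordinates sum to 0 while \<open>l j\<close> is positive, so
      one is negative. The point lies outside the dilate, both sides vanish, and the missing
      predecessor does no harm.\<close>
    have "\<not> ?pos l"
    proof
      assume pos: "?pos l"
      have "l i \<ge> 0" if "i \<in> ?I" for i using bspec[OF pos that] by (simp split: if_splits)
      then have "l j \<le> (\<Sum>i\<in>?I. l i)" using assms(2) by (intro member_le_sum) auto
      then show False using Suc.prems 0 by (simp add: cone_coords_def)
    qed
    then have "\<alpha> \<notin> lattice_points (half_open_simplex_dilate v S n)" using mem by blast
    then have "weight_on_dilates v S f' n \<alpha> = 0" for f' :: "int ^ 'd \<Rightarrow> 'r"
      by (simp add: weight_on_dilates_def)
    then show ?thesis using IH by (simp add: 0)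
  next
    case (Suc n')
    define l' where "l' = l(j := l j - 1)"
    have l: "l = l'(j := l' j + 1)" by (simp add: l'_def)
    have l': "cone_coords v ?I l' n' (\<alpha> - v j)"
      using Suc.prems(1) cone_coords_step[OF finite_atLeastAtMost assms(2)] unfolding Suc l by blast
    have j: "l' j > real k" using Suc.prems(2) by (simp add: l'_def)
    \<comment> \<open>Only coordinate \<open>j\<close> differs, and both its values are positive, so
      the strict and the weak condition hold alike.\<close>
    have "?pos l \<longleftrightarrow> ?pos l'"
      using j by (intro ball_cong) (auto simp: l)
    then have "\<alpha> - v j \<in> lattice_points (half_open_simplex_dilate v S n') \<longleftrightarrow>
        \<alpha> \<in> lattice_points (half_open_simplex_dilate v S n)"
      using mem lattice_points_dilate_iff[OF assms(1) l'] by simp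
    then show ?thesis
      using IH Suc.IH[OF l' j] by (simp add: Suc weight_on_dilates_def[of v S _ _ \<alpha>]
          weight_on_dilates_def[of v S _ _ "\<alpha> - v j"]
          backward_diff_def[of _ "(backward_diff (v j) ^^ k) f"])
  qed
qed

text \<open>True also of points without coordinates; since they are closed under subtracting
  \<open>(1, v\<^sub>i)\<close>, no spanning argument is needed.\<close>

definition far_in_direction ::
    "(nat \<Rightarrow> int ^ 'd::finite) \<Rightarrow> nat set \<Rightarrow> nat \<Rightarrow> nat \<Rightarrow> nat \<Rightarrow> int ^ 'd \<Rightarrow> bool" where
  "far_in_direction v I c j n \<alpha> \<longleftrightarrow> (\<forall>l. cone_coords v I l n \<alpha> \<longrightarrow> l j > real c)"

lemma far_in_direction_step:
  assumes "finite I" "i \<in> I" "i \<noteq> j" "far_in_direction v I c j (Suc n) \<alpha>"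
  shows "far_in_direction v I c j n (\<alpha> - v i)"
  unfolding far_in_direction_def
proof (intro allI impI)
  fix l assume "cone_coords v I l n (\<alpha> - v i)"
  then have "cone_coords v I (l(i := l i + 1)) (Suc n) \<alpha>"
    using cone_coords_step[OF assms(1,2)] by blast
  then have "(l(i := l i + 1)) j > real c"
    using assms(4) unfolding far_in_direction_def by blast
  then show "l j > real c" using assms(3) by simp
qed

text \<open>Pigeonhole: \<open>CARD('d) + 1\<close> coordinates with sum \<open>n\<close> cannot all
  be at most \<open>c\<close>. A point without coordinates is far in every direction, and index 1 is
  an arbitrary choice.\<close>

lemma far_in_some_direction:
  fixes v :: "nat \<Rightarrow> int ^ 'd::finite"
  assumes "affinely_independent_vertices v" "n > (CARD('d) + 1) * c"
  obtains j where "j \<in> {1..CARD('d) + 1}" "far_in_direction v {1..CARD('d) + 1} c j n \<alpha>"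
proof (cases "\<exists>l. cone_coords v {1..CARD('d) + 1} l n \<alpha>")
  case True
  let ?I = "{1..CARD('d) + 1}"
  from True obtain l where l: "cone_coords v ?I l n \<alpha>" ..
  have "\<exists>j\<in>?I. l j > real c"
  proof (rule ccontr)
    assume "\<not> ?thesis"
    then have "(\<Sum>i\<in>?I. l i) \<le> real (card ?I) * real c"
      by (intro sum_bounded_above) (auto simp: not_less)
    moreover have "(\<Sum>i\<in>?I. l i) = real n" using l unfolding cone_coords_def ..
    ultimately have "real n \<le> real ((CARD('d) + 1) * c)"
      by (simp only: card_atLeastAtMost of_nat_mult diff_Suc_1 Suc_eq_plus1 add_diff_cancel_right')
    then show False using assms(2) by linarith
  qed
  then obtain j where j: "j \<in> ?I" "l j > real c" by blast
  have "far_in_direction v ?I c j n \<alpha>"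
    unfolding far_in_direction_def
    using affinely_independent_vertices_coords_unique[OF assms(1) l _ j(1)] j(2) by metis
  with j(1) show ?thesis by (rule that)
next
  case False
  then have "far_in_direction v {1..CARD('d) + 1} c 1 n \<alpha>"
    by (simp add: far_in_direction_def)
  then show ?thesis by (intro that[of 1]) auto
qed

text \<open>At a point with coordinates the graded difference is the cut-off difference of
  \<open>f\<close>, which is zero. Points without coordinates form a region closed under steps on
  which the weight vanishes.\<close>

lemma graded_diff_funpow_weight_on_dilates_far:
  fixes v :: "nat \<Rightarrow> int ^ 'd::finite"
  assumes "affinely_independent_vertices v" "j \<in> {1..CARD('d) + 1}"
    and "(backward_diff (v j) ^^ c) f = (\<lambda>x. 0)"
    and "far_in_direction v {1..CARD('d) + 1} c j n \<alpha>"
  shows "(graded_diff (v j) ^^ c) (weight_on_dilates v S f) n \<alpha> = 0"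
proof (cases "\<exists>l. cone_coords v {1..CARD('d) + 1} l n \<alpha>")
  case True
  then obtain l where l: "cone_coords v {1..CARD('d) + 1} l n \<alpha>" ..
  then have "l j > real c" using assms(4) by (auto simp: far_in_direction_def)
  then have "(graded_diff (v j) ^^ c) (weight_on_dilates v S f) n \<alpha> =
      weight_on_dilates v S (\<lambda>x. 0) n \<alpha>"
    using graded_diff_funpow_weight_on_dilates[OF assms(1,2) l] assms(3) by metis
  then show ?thesis by (simp add: weight_on_dilates_def)
next
  case False
  show ?thesis
  proof (rule graded_diff_funpow_eq_0[where P = "\<lambda>n \<alpha>. \<nexists>l. cone_coords v {1..CARD('d) + 1} l n \<alpha>"])
    show "weight_on_dilates v S f n \<alpha> = 0"
      if "\<nexists>l. cone_coords v {1..CARD('d) + 1} l n \<alpha>" for n \<alpha>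
      using that lattice_points_dilate_coords[of \<alpha> v S n] by (auto simp: weight_on_dilates_def)
    show "\<nexists>l. cone_coords v {1..CARD('d) + 1} l n (\<alpha> - v j)"
      if "\<nexists>l. cone_coords v {1..CARD('d) + 1} l (Suc n) \<alpha>" for n \<alpha>
      using that cone_coords_step[OF finite_atLeastAtMost assms(2)] by blast
  qed (fact False)
qed

section \<open>Combining all directions\<close>

text \<open>The factors are multiplied in one at a time. On the far region of \<open>j\<close>, the
  current function itself vanishes if \<open>j\<close> has been treated; otherwise its
  \<open>c\<close>-fold difference along \<open>v j\<close> does.\<close>

lemma prod_graded_diff_eq_0:
  fixes \<phi> :: "int ^ 'd::finite \<Rightarrow> 'g::ab_group_add" and F :: "nat \<Rightarrow> int ^ 'd \<Rightarrow> 'r::comm_ring_1"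
  assumes "Modules.additive \<phi>" "finite I"
    and "\<And>n. finite {\<alpha>. F n \<alpha> \<noteq> 0}"
    and far: "\<And>j n \<alpha>. j \<in> I \<Longrightarrow> far_in_direction v I c j n \<alpha> \<Longrightarrow> (graded_diff (v j) ^^ c) F n \<alpha> = 0"
    and "J \<subseteq> I"
  obtains G :: "nat \<Rightarrow> int ^ 'd \<Rightarrow> 'r" where
    "graded_series \<phi> G =
       (\<Prod>i\<in>J. (1 - fps_const (Poly_Mapping.single (\<phi> (v i)) 1) * fps_X) ^ c) * graded_series \<phi> F"
    "\<And>j n \<alpha>. j \<in> J \<Longrightarrow> far_in_direction v I c j n \<alpha> \<Longrightarrow> G n \<alpha> = 0"
proof -
  let ?q = "\<lambda>i. (1 - fps_const (Poly_Mapping.single (\<phi> (v i)) (1::'r)) * fps_X) ^ c"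
  have "finite J" using assms(2,5) finite_subset by blast
  then have "\<exists>G. (\<forall>n. finite {\<alpha>. G n \<alpha> \<noteq> 0}) \<and>
      graded_series \<phi> G = (\<Prod>i\<in>J. ?q i) * graded_series \<phi> F \<and>
      (\<forall>j\<in>I. \<forall>n \<alpha>. far_in_direction v I c j n \<alpha> \<longrightarrow>
         (if j \<in> J then G n \<alpha> = 0 else (graded_diff (v j) ^^ c) G n \<alpha> = 0))"
    using assms(5)
  proof (induction J)
    case empty
    show ?case using assms(3) far by (intro exI[of _ F]) auto
  next
    case (insert i J)
    then have "J \<subseteq> I" by simp
    from insert.IH[OF this] obtain G where fin: "\<forall>n. finite {\<alpha>. G n \<alpha> \<noteq> 0}"
      and G_series: "graded_series \<phi> G = (\<Prod>i\<in>J. ?q i) * graded_series \<phi> F"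
      and G_far: "\<forall>j\<in>I. \<forall>n \<alpha>. far_in_direction v I c j n \<alpha> \<longrightarrow>
         (if j \<in> J then G n \<alpha> = 0 else (graded_diff (v j) ^^ c) G n \<alpha> = 0)"
      by blast
    have i: "i \<in> I" using insert.prems by simp
    let ?G = "(graded_diff (v i) ^^ c) G"
    have series: "(\<forall>n. finite {\<alpha>. ?G n \<alpha> \<noteq> 0}) \<and>
        graded_series \<phi> ?G = ?q i * graded_series \<phi> G"
      by (rule graded_series_graded_diff_funpow[OF assms(1) fin[rule_format]])
    have vanish: "if j \<in> insert i J then ?G n \<alpha> = 0 else (graded_diff (v j) ^^ c) ?G n \<alpha> = 0"
      if j: "j \<in> I" and f: "far_in_direction v I c j n \<alpha>" for j n \<alpha>
    proof -
      \<comment> \<open>A step along \<open>v i\<close> with \<open>i\<close> different from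
        \<open>j\<close> stays in the far region of \<open>j\<close>, so vanishing there survives
        the new differences.\<close>
      have step: "(graded_diff (v i) ^^ c) H n \<alpha> = 0"
        if "j \<noteq> i" "\<And>n \<alpha>. far_in_direction v I c j n \<alpha> \<Longrightarrow> H n \<alpha> = 0"
        for H :: "nat \<Rightarrow> int ^ 'd \<Rightarrow> 'r"
        using graded_diff_funpow_eq_0[of "far_in_direction v I c j" H "v i", OF that(2) _ f]
          far_in_direction_step[OF assms(2) i] that(1) by metis
      consider "j = i" | "j \<noteq> i" "j \<in> J" | "j \<noteq> i" "j \<notin> J" by blast
      then show ?thesis
      proof cases
        case 1
        then show ?thesis using G_far[rule_format, OF j f] insert.hyps by simp
      next
        case 2
        then have "?G n \<alpha> = 0" using G_far[rule_format, OF j] by (intro step) auto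
        with 2 show ?thesis by simp
      next
        case 3
        \<comment> \<open>For an untreated \<open>j\<close> it is the difference along
          \<open>v j\<close> that vanishes, so the two differences are interchanged.\<close>
        then have "(graded_diff (v i) ^^ c) ((graded_diff (v j) ^^ c) G) n \<alpha> = 0"
          using G_far[rule_format, OF j] by (intro step) auto
        then show ?thesis
          using 3 by (simp add: graded_diff_funpow_commute[of c "v j" c "v i"])
      qed
    qed
    show ?case
      using series vanish insert.hyps by (intro exI[of _ ?G]) (auto simp: G_series mult.assoc)
  qed
  then obtain G where "graded_series \<phi> G = (\<Prod>i\<in>J. ?q i) * graded_series \<phi> F"
    "\<forall>j\<in>I. \<forall>n \<alpha>. far_in_direction v I c j n \<alpha> \<longrightarrow>
         (if j \<in> J then G n \<alpha> = 0 else (graded_diff (v j) ^^ c) G n \<alpha> = 0)" by blast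
  with assms(5) show ?thesis by (intro that[of G]) auto
qed

section \<open>Polynomiality of the product\<close>

lemma fps_eq_fps_of_poly:
  assumes "\<And>n. n > N \<Longrightarrow> fps_nth f n = 0"
  obtains p where "f = fps_of_poly p"
proof (rule that)
  show "f = fps_of_poly (Poly (map (fps_nth f) [0..<Suc N]))"
    using assms by (intro fps_ext) (auto simp: nth_default_def simp del: upt_Suc)
qed

theorem mainTheorem6:
  fixes \<phi> :: "int ^ 'd::finite \<Rightarrow> 'g::ab_group_add"
    and v :: "nat \<Rightarrow> int ^ 'd"
    and S :: "nat set"
    and w :: "('d \<Rightarrow>\<^sub>0 nat) \<Rightarrow>\<^sub>0 'r::comm_ring_1"
    and m :: nat
  assumes "Modules.additive \<phi>"
    and "affinely_independent_vertices v"
    and "S \<subseteq> {1..CARD('d) + 1}"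
    and "mpoly_total_degree w = m"
  shows "\<exists>p :: ('g \<Rightarrow>\<^sub>0 'r) poly.
    (\<Prod>i = 1..CARD('d) + 1.
        (1 - fps_const (Poly_Mapping.single (\<phi> (v i)) 1) * fps_X) ^ (m + 1))
      * ehrhart_series v S \<phi> w = fps_of_poly p"
proof -
  let ?I = "{1..CARD('d) + 1}"
  let ?F = "weight_on_dilates v S (mpoly_eval_int w)"
  have diff: "(backward_diff u ^^ (m + 1)) (mpoly_eval_int w) = (\<lambda>x. 0)" for u
    using backward_diff_funpow_mpoly_eval_int[of w u] assms(4) by simp
  have far: "(graded_diff (v j) ^^ (m + 1)) ?F n \<alpha> = 0"
    if "j \<in> ?I" "far_in_direction v ?I (m + 1) j n \<alpha>" for j n \<alpha>
    by (rule graded_diff_funpow_weight_on_dilates_far[OF assms(2) that(1) diff that(2)])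
  obtain G where
    G: "graded_series \<phi> G =
      (\<Prod>i\<in>?I. (1 - fps_const (Poly_Mapping.single (\<phi> (v i)) 1) * fps_X) ^ (m + 1)) *
        graded_series \<phi> ?F"
    and G_far: "\<And>j n \<alpha>. j \<in> ?I \<Longrightarrow> far_in_direction v ?I (m + 1) j n \<alpha> \<Longrightarrow> G n \<alpha> = 0"
  proof (rule prod_graded_diff_eq_0[where \<phi> = \<phi> and v = v and I = ?I and J = ?I and F = ?F
          and c = "m + 1"])
    show "Modules.additive \<phi>" by fact
    show "finite {\<alpha>. ?F n \<alpha> \<noteq> 0}" for n by (rule finite_support_weight_on_dilates)
  qed (use far in auto)
  have "fps_nth (graded_series \<phi> G) n = 0" if n: "n > (CARD('d) + 1) * (m + 1)" for n
  proof -
    \<comment> \<open>The far direction may depend on \<alpha>, but \<open>G\<close> vanishes on the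
      far regions of all directions.\<close>
    have "G n \<alpha> = 0" for \<alpha>
      using far_in_some_direction[OF assms(2) n] G_far by metis
    then show ?thesis by (simp add: graded_series_def)
  qed
  then obtain p where "graded_series \<phi> G = fps_of_poly p"
    by (rule fps_eq_fps_of_poly)
  with G show ?thesis unfolding ehrhart_series_eq_graded_series by metis
qed

end
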